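(* Let $H$ be a real Hilbert space and let $A \in B(H)$ be a normal operator, i.e. $AA^{T} = A^{T}A$. Then there exists an orthogonal transformation $U \in B(H)$ such that $$UAU^{T} = A^{T}.$$ Further, $U$ can be chosen such that $U^{T} = U$.
   Context: $B(H)$ denotes the bounded real-linear operators on the real Hilbert space $H$. For $A \in B(H)$, the transpose $A^{T}\in B(H)$ is the unique bounded operator with $\langle Ax, y\rangle = \langle x, A^{T}y\rangle$ for all $x,y\in H$. An orthogonal transformation of $H$ is a bounded operator $U$ with $U^{T}U = UU^{T} = I$. *)

theory Defs
  imports "HOL-Analysis.Analysis"
begin

text \<open>
  A real Hilbert space is a type of sort \<open>{real_inner, banach}\<close>: a real inner product space,
  of arbitrary dimension, that is complete for the induced norm. \<open>B(H)\<close> is the type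
  \<open>'a \<Rightarrow>\<^sub>L 'a\<close>.
\<close>

definition blinfun_transpose ::
    "('a::{real_inner, banach} \<Rightarrow>\<^sub>L 'a) \<Rightarrow> ('a \<Rightarrow>\<^sub>L 'a)" where
  "blinfun_transpose A = (THE B :: 'a \<Rightarrow>\<^sub>L 'a. \<forall>x y. A x \<bullet> y = x \<bullet> B y)"

definition normal_blinfun :: "('a::{real_inner, banach} \<Rightarrow>\<^sub>L 'a) \<Rightarrow> bool" where
  "normal_blinfun A \<longleftrightarrow> A o\<^sub>L blinfun_transpose A = blinfun_transpose A o\<^sub>L A"

text \<open>
  The constant \<open>orthogonal_transformation\<close> of HOL-Analysis only asks for preservation of the
  inner product; in infinite dimension such a map need not be surjective.
\<close>

definition orthogonal_blinfun :: "('a::{real_inner, banach} \<Rightarrow>\<^sub>L 'a) \<Rightarrow> bool" where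
  "orthogonal_blinfun U \<longleftrightarrow>
     blinfun_transpose U o\<^sub>L U = id_blinfun \<and> U o\<^sub>L blinfun_transpose U = id_blinfun"

text \<open>
  The description operator in \<open>blinfun_transpose\<close> is well defined. The Riesz representation of
  a bounded functional \<open>f\<close> is the minimiser of \<open>(norm x)\<^sup>2 / 2 - f x\<close>.
\<close>

lemma riesz_representation:
  fixes f :: "'a::{real_inner, banach} \<Rightarrow> real"
  assumes f: "bounded_linear f"
  obtains z where "\<And>v. f v = v \<bullet> z"
proof -
  interpret f: bounded_linear f by fact
  obtain K where K: "\<And>x. norm (f x) \<le> norm x * K" using f.bounded by blast
  define J where "J x = (x \<bullet> x) / 2 - f x" for x
  define m where "m = Inf (range J)"
  have lower: "- (K\<^sup>2 / 2) \<le> J x" for x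
  proof -
    have "f x \<le> norm x * K" using K[of x] by simp
    moreover have "0 \<le> (norm x - K)\<^sup>2" by simp
    ultimately show ?thesis
      by (simp add: J_def power2_norm_eq_inner[symmetric] power2_diff)
  qed
  have bdd: "bdd_below (range J)" using lower by (auto intro!: bdd_belowI)
  have m_le: "m \<le> J x" for x unfolding m_def using bdd by (auto intro: cInf_lower)
  have "\<exists>x. J x < m + 1 / real (Suc n)" for n
  proof -
    have "Inf (range J) < m + 1 / real (Suc n)" by (simp add: m_def)
    then show ?thesis using bdd by (subst (asm) cInf_less_iff) auto
  qed
  then obtain x where x: "\<And>n. J (x n) < m + 1 / real (Suc n)" by metis
  have par: "(norm (a - b))\<^sup>2 = 4 * (J a + J b - 2 * J ((1/2) *\<^sub>R (a + b)))" for a b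
    unfolding power2_norm_eq_inner J_def
    by (simp add: f.scaleR f.add inner_commute algebra_simps)
  have close: "(norm (x i - x j))\<^sup>2 \<le> 4 * (1 / real (Suc i) + 1 / real (Suc j))" for i j
    using x[of i] x[of j] m_le[of "(1/2) *\<^sub>R (x i + x j)"] unfolding par by simp
  have "Cauchy x"
  proof (rule metric_CauchyI)
    fix e :: real assume e: "e > 0"
    then obtain N where N: "1 / real (Suc N) < e\<^sup>2 / 8"
      using nat_approx_posE[of "e\<^sup>2 / 8"] by auto
    have "dist (x i) (x j) < e" if "N \<le> i" "N \<le> j" for i j
    proof -
      have "1 / real (Suc i) \<le> 1 / real (Suc N)" "1 / real (Suc j) \<le> 1 / real (Suc N)"
        using that by (auto simp: divide_simps)
      then have "(norm (x i - x j))\<^sup>2 < e\<^sup>2" using close[of i j] N by argo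
      then show ?thesis using e by (simp add: dist_norm power2_less_imp_less)
    qed
    then show "\<exists>M. \<forall>i\<ge>M. \<forall>j\<ge>M. dist (x i) (x j) < e" by blast
  qed
  then obtain z where z: "x \<longlonglongrightarrow> z" using Cauchy_convergent_iff convergentD by blast
  have "(\<lambda>n. J (x n)) \<longlonglongrightarrow> J z" unfolding J_def by (intro tendsto_intros z f.tendsto) simp
  moreover have "(\<lambda>n. m + 1 / real (Suc n)) \<longlonglongrightarrow> m"
    using tendsto_add[OF tendsto_const LIMSEQ_inverse_real_of_nat, of m]
    by (simp add: inverse_eq_divide)
  ultimately have Jz: "J z \<le> m"
    by (rule LIMSEQ_le) (use x in \<open>auto intro: less_imp_le\<close>)
  have "f v = v \<bullet> z" for v
  proof (cases "v = 0")
    case False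
    define d where "d = v \<bullet> z - f v"
    define t where "t = - d / (v \<bullet> v)"
    have vv: "v \<bullet> v > 0" using False by simp
    have "J (z + t *\<^sub>R v) = J z + t * d + t\<^sup>2 * (v \<bullet> v) / 2"
      by (simp add: J_def d_def f.add f.scaleR inner_commute algebra_simps power2_eq_square
          add_divide_distrib)
    moreover have "t * d + t\<^sup>2 * (v \<bullet> v) / 2 = - (d\<^sup>2 / (2 * (v \<bullet> v)))"
      using vv by (simp add: t_def field_simps power2_eq_square)
    moreover have "J z \<le> J (z + t *\<^sub>R v)" using Jz m_le order_trans by blast
    ultimately have "d\<^sup>2 / (2 * (v \<bullet> v)) \<le> 0" by linarith
    then have "d = 0" using vv by (simp add: divide_le_0_iff)
    then show ?thesis by (simp add: d_def)
  qed (simp add: f.zero)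
  then show thesis using that by blast
qed

lemma blinfun_transpose_exists:
  fixes A :: "'a::{real_inner, banach} \<Rightarrow>\<^sub>L 'a"
  shows "\<exists>B :: 'a \<Rightarrow>\<^sub>L 'a. \<forall>x y. A x \<bullet> y = x \<bullet> B y"
proof -
  have "\<exists>z. \<forall>x. A x \<bullet> y = x \<bullet> z" for y
  proof -
    have "bounded_linear (\<lambda>x. A x \<bullet> y)"
      by (intro bounded_linear_inner_left_comp blinfun.bounded_linear_right)
    then obtain z where "\<And>x. A x \<bullet> y = x \<bullet> z" by (rule riesz_representation) blast
    then show ?thesis by blast
  qed
  then obtain g where g: "\<And>x y. A x \<bullet> y = x \<bullet> g y" by metis
  have "bounded_linear g"
  proof (rule bounded_linear_intro[where K = "norm A"])
    show "g (a + b) = g a + g b" for a b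
      by (subst vector_eq_ldot[symmetric]) (simp add: g[symmetric] inner_add_right)
    show "g (r *\<^sub>R a) = r *\<^sub>R g a" for r a
      by (subst vector_eq_ldot[symmetric]) (simp add: g[symmetric])
    show "norm (g a) \<le> norm a * norm A" for a
    proof (cases "g a = 0")
      case False
      have "norm (g a) * norm (g a) = A (g a) \<bullet> a"
        by (simp add: g power2_norm_eq_inner[symmetric] power2_eq_square)
      also have "\<dots> \<le> norm (A (g a)) * norm a" by (rule norm_cauchy_schwarz)
      also have "\<dots> \<le> (norm A * norm (g a)) * norm a"
        by (intro mult_right_mono norm_blinfun) simp
      finally have "norm (g a) * norm (g a) \<le> norm (g a) * (norm a * norm A)"
        by (simp add: ac_simps)
      then show ?thesis using False by simp
    qed simp
  qed
  then show ?thesis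
    by (intro exI[of _ "Blinfun g"]) (simp add: bounded_linear_Blinfun_apply g)
qed

lemma blinfun_transpose_unique:
  fixes A B :: "'a::{real_inner, banach} \<Rightarrow>\<^sub>L 'a"
  assumes "\<And>x y. A x \<bullet> y = x \<bullet> B y"
  shows "blinfun_transpose A = B"
  unfolding blinfun_transpose_def
proof (rule the_equality)
  show "C = B" if "\<forall>x y. A x \<bullet> y = x \<bullet> C y" for C :: "'a \<Rightarrow>\<^sub>L 'a"
    using that assms by (intro blinfun_eqI) (metis vector_eq_ldot)
qed (use assms in blast)

lemma inner_blinfun_transpose: "blinfun_apply A x \<bullet> y = x \<bullet> blinfun_transpose A y"
  using blinfun_transpose_exists[of A] blinfun_transpose_unique[of A] by metis

lemma blinfun_apply_blinfun_transpose:
  "blinfun_apply (blinfun_transpose A) = adjoint (blinfun_apply A)"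
  by (rule adjoint_unique[symmetric]) (simp add: inner_blinfun_transpose)

end

theory Submission
  imports Defs
begin

text \<open>
  Let \<open>\<B>\<close> be the bicommutant of \<open>{A, A\<^sup>T}\<close>. Because \<open>A\<close> is normal,
  \<open>\<B>\<close> is a commutative unital algebra closed under transposition, so each of its members is itself
  normal: \<open>\<parallel>T x\<parallel> = \<parallel>T\<^sup>T x\<parallel>\<close>. Hence on a cyclic subspace \<open>{T x | T \<in> \<B>}\<close> the rule \<open>T x \<mapsto> T\<^sup>T x\<close> is
  a well-defined isometry. It is its own inverse, because transposition is an involution, and it
  turns the action of \<open>S \<in> \<B>\<close> into that of \<open>S\<^sup>T\<close>, because \<open>(S T)\<^sup>T = S\<^sup>T T\<^sup>T\<close> in the commutative
  algebra \<open>\<B>\<close>.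

  It remains to glue such isometries along an orthogonal decomposition of \<open>H\<close> into cyclic
  subspaces. This is done by Zorn's lemma on graphs of partial isometries with these properties
  (\<open>reversal_graph\<close>). A maximal graph is closed, hence so is its domain
  (\<open>closed_reversal_domain\<close>). A nonzero vector orthogonal to the domain would generate a cyclic
  subspace orthogonal to it, and the graph could be enlarged (\<open>reversal_graph_extend\<close>). The maximal
  graph is therefore that of an everywhere defined isometry \<open>U\<close> with \<open>U U = I\<close>, and such a map is
  symmetric and orthogonal.
\<close>

section \<open>Transposition\<close>

lemma inner_blinfun_transpose_left: "blinfun_transpose A x \<bullet> y = x \<bullet> blinfun_apply A y"
  by (metis inner_blinfun_transpose inner_commute)

lemma blinfun_transpose_transpose [simp]: "blinfun_transpose (blinfun_transpose A) = A"
  by (rule blinfun_transpose_unique) (rule inner_blinfun_transpose_left)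

lemma blinfun_transpose_compose:
  "blinfun_transpose (A o\<^sub>L B) = blinfun_transpose B o\<^sub>L blinfun_transpose A"
  by (rule blinfun_transpose_unique) (simp add: inner_blinfun_transpose)

lemma blinfun_transpose_id [simp]: "blinfun_transpose id_blinfun = id_blinfun"
  by (rule blinfun_transpose_unique) simp

lemma blinfun_transpose_add:
  "blinfun_transpose (A + B) = blinfun_transpose A + blinfun_transpose B"
  by (rule blinfun_transpose_unique)
    (simp add: blinfun.add_left inner_add_left inner_add_right inner_blinfun_transpose)

lemma blinfun_transpose_scaleR: "blinfun_transpose (c *\<^sub>R A) = c *\<^sub>R blinfun_transpose A"
  by (rule blinfun_transpose_unique) (simp add: blinfun.scaleR_left inner_blinfun_transpose)

text \<open>
  Both squared norms are quadratic forms, of \<open>T\<^sup>T T\<close> and of \<open>T T\<^sup>T\<close>.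
\<close>

lemma normal_blinfun_norm_transpose:
  assumes "normal_blinfun T"
  shows "norm (T x) = norm (blinfun_transpose T x)"
proof -
  have "T x \<bullet> T x = x \<bullet> (blinfun_transpose T o\<^sub>L T) x"
    by (simp add: inner_blinfun_transpose)
  also have "\<dots> = x \<bullet> (T o\<^sub>L blinfun_transpose T) x"
    using assms by (simp add: normal_blinfun_def)
  also have "\<dots> = blinfun_transpose T x \<bullet> blinfun_transpose T x"
    by (simp add: inner_blinfun_transpose_left)
  finally show ?thesis by (simp add: norm_eq)
qed

section \<open>Commutants\<close>

definition commutant :: "('a::real_normed_vector \<Rightarrow>\<^sub>L 'a) set \<Rightarrow> ('a \<Rightarrow>\<^sub>L 'a) set" where
  "commutant M = {T. \<forall>S\<in>M. T o\<^sub>L S = S o\<^sub>L T}"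

lemma commutant_antimono: "M \<subseteq> N \<Longrightarrow> commutant N \<subseteq> commutant M"
  by (auto simp: commutant_def)

lemma subset_bicommutant: "M \<subseteq> commutant (commutant M)"
  by (auto simp: commutant_def)

lemma commutantD: "T \<in> commutant M \<Longrightarrow> S \<in> M \<Longrightarrow> T o\<^sub>L S = S o\<^sub>L T"
  by (simp add: commutant_def)

lemma id_blinfun_in_commutant: "id_blinfun \<in> commutant M"
  by (auto simp: commutant_def intro: blinfun_eqI)

lemma blinfun_compose_in_commutant:
  assumes "S \<in> commutant M" "T \<in> commutant M"
  shows "S o\<^sub>L T \<in> commutant M"
proof -
  have "S (T (R x)) = R (S (T x))" if "R \<in> M" for R x
    using commutantD[OF assms(1) that] commutantD[OF assms(2) that]
    by (metis blinfun_apply_blinfun_compose)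
  then show ?thesis by (auto simp: commutant_def intro!: blinfun_eqI)
qed

lemma subspace_commutant: "subspace (commutant M)"
  by (auto simp: subspace_def commutant_def blinfun.bilinear_simps
      bounded_bilinear.add_left[OF bounded_bilinear_blinfun_compose]
      bounded_bilinear.add_right[OF bounded_bilinear_blinfun_compose]
      bounded_bilinear.scaleR_left[OF bounded_bilinear_blinfun_compose]
      bounded_bilinear.scaleR_right[OF bounded_bilinear_blinfun_compose]
      bounded_bilinear.zero_left[OF bounded_bilinear_blinfun_compose]
      bounded_bilinear.zero_right[OF bounded_bilinear_blinfun_compose])

lemma blinfun_transpose_in_commutant:
  assumes M: "\<And>S. S \<in> M \<Longrightarrow> blinfun_transpose S \<in> M" and T: "T \<in> commutant M"
  shows "blinfun_transpose T \<in> commutant M"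
proof -
  have "blinfun_transpose T o\<^sub>L S = S o\<^sub>L blinfun_transpose T" if "S \<in> M" for S
  proof -
    have "blinfun_transpose (T o\<^sub>L blinfun_transpose S)
        = blinfun_transpose (blinfun_transpose S o\<^sub>L T)"
      using commutantD[OF T M[OF that]] by simp
    then show ?thesis by (simp add: blinfun_transpose_compose)
  qed
  then show ?thesis by (simp add: commutant_def)
qed

section \<open>Closed subspaces\<close>

lemma subspace_closure:
  fixes S :: "'a::real_normed_vector set"
  assumes S: "subspace S"
  shows "subspace (closure S)"
  unfolding subspace_def
proof (intro conjI ballI allI)
  show "0 \<in> closure S" using subspace_0[OF S] closure_subset by blast
next
  fix a b assume "a \<in> closure S" "b \<in> closure S"
  then obtain f g where f: "\<And>n. f n \<in> S" "f \<longlonglongrightarrow> a" and g: "\<And>n. g n \<in> S" "g \<longlonglongrightarrow> b"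
    unfolding closure_sequential by blast
  show "a + b \<in> closure S"
    unfolding closure_sequential
    by (rule exI[of _ "\<lambda>n. f n + g n"]) (use f g in \<open>auto intro: subspace_add[OF S] tendsto_add\<close>)
next
  fix c :: real and a assume "a \<in> closure S"
  then obtain f where f: "\<And>n. f n \<in> S" "f \<longlonglongrightarrow> a"
    unfolding closure_sequential by blast
  show "c *\<^sub>R a \<in> closure S"
    unfolding closure_sequential
    by (rule exI[of _ "\<lambda>n. c *\<^sub>R f n"])
      (use f in \<open>auto intro: subspace_scale[OF S] tendsto_scaleR\<close>)
qed

text \<open>
  The vector is \<open>p - z\<close> for a point \<open>p\<close> outside the subspace \<open>S\<close> and its nearest point \<open>z\<close> in \<open>S\<close>. The
  parallelogram law makes minimising sequences Cauchy, and completeness provides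
  their limit \<open>z\<close>.
\<close>

lemma closed_proper_subspace_orthogonal:
  fixes S :: "'a::{real_inner, banach} set"
  assumes S: "subspace S" "closed S" and "S \<noteq> UNIV"
  obtains x where "x \<noteq> 0" "\<forall>v\<in>S. x \<bullet> v = 0"
proof -
  obtain p where p: "p \<notin> S" using \<open>S \<noteq> UNIV\<close> by blast
  define J where "J s = (norm (p - s))\<^sup>2" for s
  define m where "m = Inf (J ` S)"
  have ne: "J ` S \<noteq> {}" using subspace_0[OF S(1)] by blast
  have bdd: "bdd_below (J ` S)" by (auto intro!: bdd_belowI[of _ 0] simp: J_def)
  have m_le: "m \<le> J s" if "s \<in> S" for s
    unfolding m_def using bdd that by (auto intro: cInf_lower)
  have "\<exists>x\<in>S. J x < m + 1 / real (Suc n)" for n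
  proof -
    have "Inf (J ` S) < m + 1 / real (Suc n)" by (simp add: m_def)
    then show ?thesis using bdd ne by (subst (asm) cInf_less_iff) auto
  qed
  then obtain x where x: "\<And>n. x n \<in> S" "\<And>n. J (x n) < m + 1 / real (Suc n)" by metis
  have par: "(norm (a - b))\<^sup>2 = 2 * (J a + J b - 2 * J ((1/2) *\<^sub>R (a + b)))" for a b
    unfolding power2_norm_eq_inner J_def
    by (simp add: inner_commute algebra_simps)
  have close: "(norm (x i - x j))\<^sup>2 \<le> 2 * (1 / real (Suc i) + 1 / real (Suc j))" for i j
  proof -
    have "(1/2) *\<^sub>R (x i + x j) \<in> S" by (intro subspace_scale subspace_add S x)
    then show ?thesis using x(2)[of i] x(2)[of j] m_le unfolding par by fastforce
  qed
  have "Cauchy x"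
  proof (rule metric_CauchyI)
    fix e :: real assume e: "e > 0"
    then obtain N where N: "1 / real (Suc N) < e\<^sup>2 / 4"
      using nat_approx_posE[of "e\<^sup>2 / 4"] by auto
    have "dist (x i) (x j) < e" if "N \<le> i" "N \<le> j" for i j
    proof -
      have "1 / real (Suc i) \<le> 1 / real (Suc N)" "1 / real (Suc j) \<le> 1 / real (Suc N)"
        using that by (auto simp: divide_simps)
      then have "(norm (x i - x j))\<^sup>2 < e\<^sup>2" using close[of i j] N by argo
      then show ?thesis using e by (simp add: dist_norm power2_less_imp_less)
    qed
    then show "\<exists>M. \<forall>i\<ge>M. \<forall>j\<ge>M. dist (x i) (x j) < e" by blast
  qed
  then obtain z where z: "x \<longlonglongrightarrow> z" using Cauchy_convergent_iff convergentD by blast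
  have zS: "z \<in> S" using closed_sequentially[OF S(2)] x(1) z by blast
  have "(\<lambda>n. J (x n)) \<longlonglongrightarrow> J z" unfolding J_def by (intro tendsto_intros z)
  moreover have "(\<lambda>n. m + 1 / real (Suc n)) \<longlonglongrightarrow> m"
    using tendsto_add[OF tendsto_const LIMSEQ_inverse_real_of_nat, of m]
    by (simp add: inverse_eq_divide)
  ultimately have Jz: "J z \<le> m"
    by (rule LIMSEQ_le) (use x in \<open>auto intro: less_imp_le\<close>)
  have "(p - z) \<bullet> v = 0" if v: "v \<in> S" for v
  proof (cases "v = 0")
    case False
    define d where "d = (p - z) \<bullet> v"
    \<comment> \<open>the step that minimises \<open>J\<close> on the line \<open>z + \<real> v\<close>\<close>
    define t where "t = d / (v \<bullet> v)"
    have vv: "v \<bullet> v > 0" using False by simp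
    have "J (z + t *\<^sub>R v) = J z - 2 * t * d + t\<^sup>2 * (v \<bullet> v)"
      unfolding J_def d_def power2_norm_eq_inner
      by (simp add: inner_commute algebra_simps power2_eq_square)
    also have "\<dots> = J z - d\<^sup>2 / (v \<bullet> v)"
      using vv by (simp add: t_def field_simps power2_eq_square)
    finally have "J (z + t *\<^sub>R v) = J z - d\<^sup>2 / (v \<bullet> v)" .
    moreover have "J z \<le> J (z + t *\<^sub>R v)"
      using Jz m_le[of "z + t *\<^sub>R v"] S(1) zS v
      by (meson order_trans subspace_add subspace_scale)
    ultimately have "d\<^sup>2 / (v \<bullet> v) \<le> 0" by linarith
    then have "d = 0" using vv by (simp add: divide_le_0_iff)
    then show ?thesis by (simp add: d_def)
  qed simp
  moreover have "p - z \<noteq> 0" using p zS by auto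
  ultimately show thesis using that by blast
qed

section \<open>Symmetric isometries exchanging operators with their transposes\<close>

locale commutative_transpose_algebra =
  fixes B :: "('a::{real_inner, banach} \<Rightarrow>\<^sub>L 'a) set"
  assumes subspace: "subspace B"
    and id_in: "id_blinfun \<in> B"
    and compose_in: "S \<in> B \<Longrightarrow> T \<in> B \<Longrightarrow> S o\<^sub>L T \<in> B"
    and transpose_in: "T \<in> B \<Longrightarrow> blinfun_transpose T \<in> B"
    and commute: "S \<in> B \<Longrightarrow> T \<in> B \<Longrightarrow> S o\<^sub>L T = T o\<^sub>L S"
begin

text \<open>
  Such a set is the graph of a partial isometric involution that intertwines each \<open>T \<in> B\<close> with its
  transpose. Working with graphs makes both the union of a chain and the closure immediate.
\<close>

definition reversal_graph :: "('a \<times> 'a) set \<Rightarrow> bool" where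
  "reversal_graph G \<longleftrightarrow> subspace G \<and>
     (\<forall>x y. (x, y) \<in> G \<longrightarrow> norm x = norm y \<and> (y, x) \<in> G \<and>
        (\<forall>T\<in>B. (blinfun_apply T x, blinfun_transpose T y) \<in> G))"

lemma reversal_graphD:
  assumes "reversal_graph G"
  shows "subspace G"
    and "(x, y) \<in> G \<Longrightarrow> norm x = norm y"
    and "(x, y) \<in> G \<Longrightarrow> (y, x) \<in> G"
    and "(x, y) \<in> G \<Longrightarrow> T \<in> B \<Longrightarrow> (blinfun_apply T x, blinfun_transpose T y) \<in> G"
  using assms by (auto simp: reversal_graph_def)

lemma reversal_graph_zero: "reversal_graph {0}"
  unfolding reversal_graph_def
  by (intro conjI subspace_single_0) (auto simp: zero_prod_def blinfun.zero_right)

lemma reversal_graph_Union: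
  assumes "\<C> \<noteq> {}" and chain: "subset.chain {G. reversal_graph G} \<C>"
  shows "reversal_graph (\<Union>\<C>)"
proof -
  have G: "reversal_graph G" if "G \<in> \<C>" for G
    using chain that by (auto simp: subset_chain_def)
  have "subspace (\<Union>\<C>)"
    unfolding subspace_def
  proof (intro conjI ballI allI)
    show "0 \<in> \<Union>\<C>" using \<open>\<C> \<noteq> {}\<close> G reversal_graphD(1) subspace_0 by blast
  next
    fix a b assume "a \<in> \<Union>\<C>" "b \<in> \<Union>\<C>"
    then obtain K where "K \<in> \<C>" "a \<in> K" "b \<in> K"
      using chain unfolding subset_chain_def by blast
    then show "a + b \<in> \<Union>\<C>" using G reversal_graphD(1) subspace_add by blast
  next
    fix c :: real and a assume "a \<in> \<Union>\<C>"
    then show "c *\<^sub>R a \<in> \<Union>\<C>" using G reversal_graphD(1) subspace_scale by blast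
  qed
  then show ?thesis using G by (fastforce simp: reversal_graph_def)
qed

lemma reversal_graph_closure:
  assumes G: "reversal_graph G"
  shows "reversal_graph (closure G)"
proof -
  have "closure G \<subseteq> {w. norm (fst w) = norm (snd w)}"
    by (intro closure_minimal closed_Collect_eq continuous_intros)
      (auto dest: reversal_graphD(2)[OF G])
  moreover have "closure G \<subseteq> (\<lambda>w. (snd w, fst w)) -` closure G"
  proof (intro closure_minimal closed_vimage closed_closure continuous_intros)
    show "G \<subseteq> (\<lambda>w. (snd w, fst w)) -` closure G"
      using subsetD[OF closure_subset reversal_graphD(3)[OF G]] by auto
  qed
  moreover have "closure G \<subseteq> (\<lambda>w. (blinfun_apply T (fst w), blinfun_transpose T (snd w))) -` closure G"
    if "T \<in> B" for T
  proof (intro closure_minimal closed_vimage closed_closure continuous_intros)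
    show "G \<subseteq> (\<lambda>w. (blinfun_apply T (fst w), blinfun_transpose T (snd w))) -` closure G"
      using subsetD[OF closure_subset reversal_graphD(4)[OF G _ that]] by auto
  qed
  ultimately show ?thesis
    using subspace_closure reversal_graphD(1)[OF G] unfolding reversal_graph_def by fastforce
qed

text \<open>
  On the graph of an isometry the first projection only scales the norm, so it preserves
  completeness.
\<close>

lemma closed_reversal_domain:
  assumes G: "reversal_graph G" and "closed G"
  shows "closed (fst ` G)"
proof -
  have "complete (fst ` G)"
  proof (rule complete_isometric_image)
    show "0 < 1 / sqrt 2" by simp
    show "subspace G" by (rule reversal_graphD(1)[OF G])
    show "bounded_linear (fst :: 'a \<times> 'a \<Rightarrow> 'a)" by (rule bounded_linear_fst)
    show "\<forall>w\<in>G. norm (fst w) \<ge> 1 / sqrt 2 * norm w"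
      using reversal_graphD(2)[OF G] by (auto simp: norm_prod_def real_sqrt_mult)
    show "complete G" using \<open>closed G\<close> by (simp add: complete_eq_closed)
  qed
  then show ?thesis by (rule complete_imp_closed)
qed

text \<open>
  The added graph is \<open>{(T x, T\<^sup>T x) | T \<in> B}\<close>. Its domain is orthogonal to the old one, since
  \<open>\<langle>T x, d\<rangle> = \<langle>x, T\<^sup>T d\<rangle>\<close> and the old domain is invariant under \<open>B\<close>; by Pythagoras the sum of the
  two isometries is isometric.
\<close>

lemma reversal_graph_extend:
  assumes G: "reversal_graph G" and x: "\<forall>v\<in>fst ` G. x \<bullet> v = 0"
  obtains G' where "reversal_graph G'" "G \<subseteq> G'" "(x, x) \<in> G'"
proof -
  define C where "C = (\<lambda>T. (blinfun_apply T x, blinfun_apply (blinfun_transpose T) x)) ` B"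
  define G' where "G' = {g + c | g c. g \<in> G \<and> c \<in> C}"
  have "linear (\<lambda>T. (blinfun_apply T x, blinfun_apply (blinfun_transpose T) x))"
    by (rule linearI)
      (simp_all add: blinfun.bilinear_simps blinfun_transpose_add blinfun_transpose_scaleR)
  then have C: "subspace C" unfolding C_def by (rule linear_subspace_image[OF _ subspace])
  have ortho: "T x \<bullet> u = 0" if "T \<in> B" "(u, v) \<in> G" for T u v
  proof -
    have "blinfun_transpose T u \<in> fst ` G"
      using reversal_graphD(4)[OF G that(2) transpose_in[OF that(1)]] by force
    then show ?thesis using bspec[OF x] by (simp add: inner_blinfun_transpose)
  qed
  have pair: "norm a = norm b \<and> (b, a) \<in> G' \<and> (\<forall>S\<in>B. (blinfun_apply S a, blinfun_transpose S b) \<in> G')"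
    if "(a, b) \<in> G'" for a b
  proof -
    obtain u v T where uv: "(u, v) \<in> G" and T: "T \<in> B"
      and ab: "a = u + T x" "b = v + blinfun_transpose T x"
      using \<open>(a, b) \<in> G'\<close> unfolding G'_def C_def by fastforce
    have T': "blinfun_transpose T \<in> B" by (rule transpose_in[OF T])
    have vu: "(v, u) \<in> G" by (rule reversal_graphD(3)[OF G uv])
    have "normal_blinfun T" unfolding normal_blinfun_def by (rule commute[OF T T'])
    then have "norm (T x) = norm (blinfun_transpose T x)" by (rule normal_blinfun_norm_transpose)
    moreover have "norm u = norm v" by (rule reversal_graphD(2)[OF G uv])
    moreover have "T x \<bullet> u = 0" "blinfun_transpose T x \<bullet> v = 0"
      using ortho[OF T uv] ortho[OF T' vu] by auto
    ultimately have "norm a = norm b"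
      unfolding ab norm_eq by (simp add: inner_add_left inner_add_right inner_commute)
    moreover have "(b, a) \<in> G'"
    proof -
      have "(blinfun_transpose T x, T x) \<in> C"
        unfolding C_def using T' by (intro image_eqI[where x = "blinfun_transpose T"]) auto
      then have "(v, u) + (blinfun_transpose T x, T x) \<in> G'" unfolding G'_def using vu by blast
      then show ?thesis by (simp add: ab)
    qed
    moreover have "(S a, blinfun_transpose S b) \<in> G'" if S: "S \<in> B" for S
    proof -
      have "blinfun_transpose (S o\<^sub>L T) = blinfun_transpose S o\<^sub>L blinfun_transpose T"
        unfolding blinfun_transpose_compose
        by (rule commute[OF transpose_in[OF T] transpose_in[OF S]])
      then have "(S (T x), blinfun_transpose S (blinfun_transpose T x)) \<in> C"
        unfolding C_def using compose_in[OF S T] by (intro image_eqI[where x = "S o\<^sub>L T"]) auto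
      moreover have "(S u, blinfun_transpose S v) \<in> G" by (rule reversal_graphD(4)[OF G uv S])
      ultimately have "(S u, blinfun_transpose S v)
          + (S (T x), blinfun_transpose S (blinfun_transpose T x)) \<in> G'"
        unfolding G'_def by blast
      then show ?thesis by (simp add: ab blinfun.add_right)
    qed
    ultimately show ?thesis by blast
  qed
  have "subspace G'"
    unfolding G'_def by (rule subspace_sums[OF reversal_graphD(1)[OF G] C])
  then have "reversal_graph G'" unfolding reversal_graph_def using pair by blast
  moreover have "G \<subseteq> G'"
  proof
    fix g assume "g \<in> G"
    then have "g + 0 \<in> G'" unfolding G'_def using subspace_0[OF C] by blast
    then show "g \<in> G'" by simp
  qed
  moreover have "(x, x) \<in> G'"
  proof -
    have "(x, x) \<in> C" unfolding C_def using id_in by (intro image_eqI[where x = id_blinfun]) auto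
    then have "0 + (x, x) \<in> G'"
      unfolding G'_def using subspace_0[OF reversal_graphD(1)[OF G]] by blast
    then show ?thesis by simp
  qed
  ultimately show thesis using that by blast
qed

text \<open>
  In a maximal graph \<open>G\<close>, a vector \<open>x\<close> orthogonal to the domain satisfies \<open>(x, x) \<in> G\<close> by the
  extension above; it then lies in the domain and is orthogonal to itself.
\<close>

lemma total_reversal_graph:
  obtains G where "reversal_graph G" "fst ` G = UNIV"
proof -
  have "\<exists>M\<in>{G. reversal_graph G}. \<forall>X\<in>{G. reversal_graph G}. M \<subseteq> X \<longrightarrow> X = M"
    by (rule subset_Zorn_nonempty) (use reversal_graph_zero reversal_graph_Union in auto)
  then obtain G where G: "reversal_graph G"
    and max: "\<And>X. reversal_graph X \<Longrightarrow> G \<subseteq> X \<Longrightarrow> X = G" by blast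
  have "closure G = G" by (rule max[OF reversal_graph_closure[OF G] closure_subset])
  then have "closed G" using closed_closure by metis
  then have cl: "closed (fst ` G)" by (rule closed_reversal_domain[OF G])
  have sub: "subspace (fst ` G)"
    by (rule linear_subspace_image[OF _ reversal_graphD(1)[OF G]]) (simp add: linear_fst)
  have "fst ` G = UNIV"
  proof (rule ccontr)
    assume "fst ` G \<noteq> UNIV"
    then obtain x where x: "x \<noteq> 0" "\<forall>v\<in>fst ` G. x \<bullet> v = 0"
      using closed_proper_subspace_orthogonal[OF sub cl] by metis
    obtain G' where G': "reversal_graph G'" "G \<subseteq> G'" and xx: "(x, x) \<in> G'"
      using reversal_graph_extend[OF G x(2)] by metis
    have "(x, x) \<in> G" using xx max[OF G'] by simp
    then have "x \<bullet> x = 0" using bspec[OF x(2)] image_eqI[of x fst "(x, x)" G] by simp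
    then show False using x(1) by simp
  qed
  then show thesis using that G by blast
qed

text \<open>
  A total graph is the graph of an isometric involution \<open>f\<close> of the whole space, and such a map is
  symmetric: \<open>\<langle>f x, y\<rangle> = \<langle>f (f x), f y\<rangle> = \<langle>x, f y\<rangle>\<close>.
\<close>

theorem exists_symmetric_isometry_transposing:
  obtains U where "blinfun_transpose U = U" "U o\<^sub>L U = id_blinfun"
    "\<And>T. T \<in> B \<Longrightarrow> U o\<^sub>L T o\<^sub>L U = blinfun_transpose T"
proof -
  obtain G where G: "reversal_graph G" and total: "fst ` G = UNIV" by (rule total_reversal_graph)
  note sub = reversal_graphD(1)[OF G]
  have uniq: "y = y'" if "(x, y) \<in> G" "(x, y') \<in> G" for x y y'
    using reversal_graphD(2)[OF G, of 0 "y - y'"] subspace_diff[OF sub that] by simp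
  have "\<exists>y. (x, y) \<in> G" for x
  proof -
    have "x \<in> fst ` G" using total by simp
    then show ?thesis by force
  qed
  then obtain f where f: "\<And>x. (x, f x) \<in> G" by metis
  have f_eq: "f x = y" if "(x, y) \<in> G" for x y using uniq f that by blast
  have add: "f (x + y) = f x + f y" for x y
    by (rule f_eq) (use subspace_add[OF sub f[of x] f[of y]] in simp)
  have scale: "f (c *\<^sub>R x) = c *\<^sub>R f x" for c x
    by (rule f_eq) (use subspace_scale[OF sub f[of x]] in simp)
  have norm: "norm (f x) = norm x" for x using reversal_graphD(2)[OF G f] by simp
  have invol: "f (f x) = x" for x by (rule f_eq[OF reversal_graphD(3)[OF G f]])
  have apply_T: "f (T x) = blinfun_transpose T (f x)" if "T \<in> B" for T x
    by (rule f_eq[OF reversal_graphD(4)[OF G f that]])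
  have "bounded_linear f"
    by (rule bounded_linear_intro[where K = 1]) (simp_all add: add scale norm)
  then have U: "blinfun_apply (Blinfun f) = f" by (rule bounded_linear_Blinfun_apply)
  have inner: "f x \<bullet> f y = x \<bullet> y" for x y
    using norm[of "x + y"] norm[of x] norm[of y]
    by (simp add: add norm_eq inner_add_left inner_add_right inner_commute)
  show thesis
  proof (rule that[of "Blinfun f"])
    show "blinfun_transpose (Blinfun f) = Blinfun f"
      by (rule blinfun_transpose_unique) (metis U inner invol)
    show "Blinfun f o\<^sub>L Blinfun f = id_blinfun"
      by (rule blinfun_eqI) (simp add: U invol)
    show "Blinfun f o\<^sub>L T o\<^sub>L Blinfun f = blinfun_transpose T" if "T \<in> B" for T
      by (rule blinfun_eqI) (simp add: U apply_T[OF that] invol)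
  qed
qed

end

section \<open>The bicommutant of a normal operator\<close>

text \<open>
  Normality says that \<open>{A, A\<^sup>T}\<close> is contained in its commutant; passing to commutants twice, the
  bicommutant is contained in the commutant, and is therefore commutative.
\<close>

lemma normal_bicommutant:
  fixes A :: "'a::{real_inner, banach} \<Rightarrow>\<^sub>L 'a"
  assumes "normal_blinfun A"
  shows "commutative_transpose_algebra (commutant (commutant {A, blinfun_transpose A}))"
proof
  let ?M = "{A, blinfun_transpose A}"
  have "?M \<subseteq> commutant ?M" using assms by (auto simp: commutant_def normal_blinfun_def)
  then have sub: "commutant (commutant ?M) \<subseteq> commutant ?M" by (rule commutant_antimono)
  show "S o\<^sub>L T = T o\<^sub>L S"
    if "S \<in> commutant (commutant ?M)" "T \<in> commutant (commutant ?M)" for S T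
    using commutantD that sub by blast
  have "blinfun_transpose S \<in> commutant ?M" if "S \<in> commutant ?M" for S
    by (rule blinfun_transpose_in_commutant[OF _ that]) auto
  then show "blinfun_transpose T \<in> commutant (commutant ?M)"
    if "T \<in> commutant (commutant ?M)" for T
    using that by (rule blinfun_transpose_in_commutant)
qed (rule subspace_commutant id_blinfun_in_commutant blinfun_compose_in_commutant; assumption)+

theorem theorem3p1:
  fixes A :: "'a::{real_inner, banach} \<Rightarrow>\<^sub>L 'a"
  assumes "normal_blinfun A"
  shows "\<exists>U :: 'a \<Rightarrow>\<^sub>L 'a. orthogonal_blinfun U
           \<and> U o\<^sub>L A o\<^sub>L blinfun_transpose U = blinfun_transpose A
           \<and> blinfun_transpose U = U"
proof -
  interpret commutative_transpose_algebra "commutant (commutant {A, blinfun_transpose A})"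
    by (rule normal_bicommutant[OF assms])
  have "A \<in> commutant (commutant {A, blinfun_transpose A})" using subset_bicommutant by blast
  then obtain U where "blinfun_transpose U = U" "U o\<^sub>L U = id_blinfun"
    "U o\<^sub>L A o\<^sub>L U = blinfun_transpose A"
    using exists_symmetric_isometry_transposing by metis
  then show ?thesis by (intro exI[of _ U]) (simp add: orthogonal_blinfun_def)
qed

end
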